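(* Let $w\in S_n$ be a permutation that avoids the patterns $1432$ and $1423$, and let $u$ be a subword of $w$. Then \[ \sum_{u\le v\le w} (-1)^{|w|-|v|}\, \mathfrak{S}_{\mathrm{perm}(v)}(\mathbf{1}) \ge 0, \] where the sum ranges over all words $v$ such that $u$ is a subword of $v$ and $v$ is a subword of $w$, and $\mathfrak{S}_{\pi}(\mathbf{1})$ denotes the value of the Schubert polynomial $\mathfrak{S}_\pi$ with all variables set to $1$.
   Context: Permutations are written in one-line notation and regarded as words; $|v|$ is the length of a word $v$. For words $u,v$, $u\le v$ means $u$ occurs as a subword of $v$, i.e. $u=v(i_1)\cdots v(i_{|u|})$ for some $1\le i_1<\dots<i_{|u|}\le|v|$ (the empty word is a subword of every word). A permutation $w$ avoids a pattern $\pi\in S_k$ if no subword of $w$ of length $k$ has its letters in the same relative order as $\pi$. For a word $v$ with distinct letters, $\mathrm{perm}(v)\in S_{|v|}$ is the permutation whose entries have the same relative order as the letters of $v$. *)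

theory Defs
  imports
    Main
    "HOL-Library.Poly_Mapping"
    "HOL-Library.Sublist"
    "HOL-Combinatorics.Transposition"
    "HOL-Combinatorics.Multiset_Permutations"
begin

text \<open>A permutation in \<open>S\<^sub>n\<close> is the word \<open>w(1) \<dots> w(n)\<close>, i.e. an element of
  \<^term>\<open>permutations_of_set {1..n}\<close>. The subword relation \<open>u \<le> v\<close> is
  \<^term>\<open>subseq u v\<close>.\<close>

definition same_relative_order :: "nat list \<Rightarrow> nat list \<Rightarrow> bool" where
  "same_relative_order u v \<longleftrightarrow>
     length u = length v \<and>
     (\<forall>i<length u. \<forall>j<length u. u ! i < u ! j \<longleftrightarrow> v ! i < v ! j)"

definition avoids :: "nat list \<Rightarrow> nat list \<Rightarrow> bool" where
  "avoids w p \<longleftrightarrow>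
     \<not> (\<exists>v. subseq v w \<and> length v = length p \<and> same_relative_order v p)"

text \<open>Each letter is replaced by its rank (starting from 1) among the letters of the word.\<close>

definition perm :: "nat list \<Rightarrow> nat list" where
  "perm v = map (\<lambda>a. card {b \<in> set v. b \<le> a}) v"

lemma card_rank_less:
  assumes "(b :: nat) \<in> set v" "a < b"
  shows "card {c \<in> set v. c \<le> a} < card {c \<in> set v. c \<le> b}"
proof (rule psubset_card_mono)
  have "b \<in> {c \<in> set v. c \<le> b}" "b \<notin> {c \<in> set v. c \<le> a}"
    using assms by auto
  moreover have "{c \<in> set v. c \<le> a} \<subseteq> {c \<in> set v. c \<le> b}"
    using assms by auto
  ultimately show "{c \<in> set v. c \<le> a} \<subset> {c \<in> set v. c \<le> b}"
    by blast
qed simp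

lemma perm_in_permutations_of_set:
  assumes "distinct v"
  shows "perm v \<in> permutations_of_set {1..length v}"
proof -
  let ?r = "\<lambda>a. card {b \<in> set v. b \<le> a}"
  have mono: "?r a < ?r b" if "a \<in> set v" "b \<in> set v" "a < b" for a b
    using that by (intro card_rank_less)
  have inj: "inj_on ?r (set v)"
  proof (rule inj_onI, rule ccontr)
    fix a b assume *: "a \<in> set v" "b \<in> set v" "?r a = ?r b" and "a \<noteq> b"
    then consider "a < b" | "b < a" by linarith
    then show False using mono[of a b] mono[of b a] * by cases linarith+
  qed
  have "?r a \<le> card (set v)" for a
    by (rule card_mono) auto
  moreover have "?r a \<ge> 1" if "a \<in> set v" for a
    using that by (auto simp: Suc_le_eq card_gt_0_iff)
  ultimately have "?r ` set v \<subseteq> {1..length v}"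
    using distinct_card[OF assms] by auto
  moreover have "card (?r ` set v) = card {1..length v}"
    using card_image[OF inj] distinct_card[OF assms] by simp
  ultimately have "?r ` set v = {1..length v}"
    by (intro card_subset_eq) auto
  with inj assms show ?thesis
    by (auto simp: perm_def permutations_of_set_def distinct_map)
qed

lemma same_relative_order_perm: "same_relative_order (perm v) v"
proof -
  let ?r = "\<lambda>a. card {b \<in> set v. b \<le> a}"
  have "?r a < ?r b" if "b \<in> set v" "a < b" for a b
    using that by (intro card_rank_less)
  moreover have "?r a \<le> ?r b" if "a \<le> b" for a b
    by (rule card_mono) (use that in auto)
  ultimately have "?r a < ?r b \<longleftrightarrow> a < b" if "b \<in> set v" for a b
    using that by (meson linorder_not_le)
  then show ?thesis
    by (simp add: same_relative_order_def perm_def)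
qed

text \<open>Polynomials with integer coefficients in the variables \<open>x\<^sub>1, x\<^sub>2, \<dots>\<close>: finitely
  supported maps from exponent vectors to coefficients, with the ring structure of
  \<^theory>\<open>HOL-Library.Poly_Mapping\<close>. (The variable with index 0 is never used.)\<close>

type_synonym ipoly = "(nat \<Rightarrow>\<^sub>0 nat) \<Rightarrow>\<^sub>0 int"

definition pvar :: "nat \<Rightarrow> ipoly" where
  "pvar i = Poly_Mapping.single (Poly_Mapping.single i 1) 1"

definition poly_eval :: "(nat \<Rightarrow> int) \<Rightarrow> ipoly \<Rightarrow> int" where
  "poly_eval c f = (\<Sum>m\<in>Poly_Mapping.keys f. Poly_Mapping.lookup f m *
     (\<Prod>i\<in>Poly_Mapping.keys m. c i ^ Poly_Mapping.lookup m i))"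

text \<open>\<open>Poly_Mapping.map_key g f\<close> is \<open>f \<circ> g\<close> for injective \<open>g\<close>; thus
  \<open>swap_vars i\<close> exchanges the variables \<open>x\<^sub>i\<close> and \<open>x\<^bsub>i+1\<^esub>\<close>.\<close>

definition swap_vars :: "nat \<Rightarrow> ipoly \<Rightarrow> ipoly" where
  "swap_vars i = Poly_Mapping.map_key (Poly_Mapping.map_key (transpose i (Suc i)))"

text \<open>\<open>\<partial>\<^sub>i f = (f - s\<^sub>i f) / (x\<^sub>i - x\<^bsub>i+1\<^esub>)\<close>; the quotient exists and is unique by
  \<open>ex1_divided_difference\<close> below.\<close>

definition divided_difference :: "nat \<Rightarrow> ipoly \<Rightarrow> ipoly" where
  "divided_difference i f = (THE g. f - swap_vars i f = (pvar i - pvar (Suc i)) * g)"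

lemma pvar_power: "pvar i ^ k = Poly_Mapping.single (Poly_Mapping.single i k) 1"
  by (induction k)
    (auto simp: pvar_def mult_single single_add[symmetric] simp flip: single_one)

lemma inj_map_key_transpose: "inj (Poly_Mapping.map_key (transpose i j) :: (nat \<Rightarrow>\<^sub>0 nat) \<Rightarrow> _)"
  by (rule inj_on_inverseI[where g = "Poly_Mapping.map_key (transpose i j)"])
    (simp add: map_key_compose map_key_id[unfolded id_def] flip: id_def,
     simp add: id_def map_key_id)

lemma map_key_transpose_single:
  "Poly_Mapping.map_key (transpose i j) (Poly_Mapping.single k c) =
     Poly_Mapping.single (transpose i j k) (c :: nat)"
  using map_key_single[of "transpose i j" "transpose i j k" c] by simp

lemma swap_vars_single:
  "swap_vars i (Poly_Mapping.single m c) =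
     Poly_Mapping.single (Poly_Mapping.map_key (transpose i (Suc i)) m) c"
proof -
  let ?t = "Poly_Mapping.map_key (transpose i (Suc i))"
  have "?t (?t m) = m"
    by (simp add: map_key_compose) (simp add: id_def map_key_id)
  then show ?thesis
    using map_key_single[OF inj_map_key_transpose[of i "Suc i"], of "?t m" c]
    by (simp add: swap_vars_def)
qed

lemma swap_vars_add: "swap_vars i (f + g) = swap_vars i f + swap_vars i g"
  by (simp add: swap_vars_def map_key_plus inj_map_key_transpose)

lemma dvd_power_swap:
  fixes x y :: "'a :: comm_ring_1"
  shows "(x - y) dvd (x ^ a * y ^ b - x ^ b * y ^ a)"
proof -
  have *: "(x - y) dvd (x ^ a * y ^ b - x ^ b * y ^ a)" if "b \<le> a"
    for a b :: nat and x y :: 'a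
  proof -
    obtain k where k: "a = b + k" using \<open>b \<le> a\<close> le_Suc_ex by blast
    have "x ^ a * y ^ b - x ^ b * y ^ a = x ^ b * y ^ b * (x ^ k - y ^ k)"
      by (simp add: k power_add algebra_simps)
    moreover have "(x - y) dvd (x ^ k - y ^ k)"
      by (metis dvd_triv_left power_diff_sumr2)
    ultimately show ?thesis by simp
  qed
  show ?thesis
    using *[of b a x y] *[of a b x y] dvd_minus_iff[of "x - y" "x ^ b * y ^ a - x ^ a * y ^ b"]
    by (cases "b \<le> a") auto
qed

lemma dvd_diff_swap_vars: "(pvar i - pvar (Suc i)) dvd (f - swap_vars i f)"
proof (induction f rule: update_induct)
  case const
  then show ?case by (simp add: swap_vars_def inj_map_key_transpose)
next
  case (update f m c)
  have upd: "Poly_Mapping.update m c f = f + Poly_Mapping.single m c"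
    using update.hyps
    by (intro poly_mapping_eqI)
      (auto simp: lookup_update lookup_add lookup_single when_def in_keys_iff)
  define a b where "a = Poly_Mapping.lookup m i" and "b = Poly_Mapping.lookup m (Suc i)"
  define r where "r = Poly_Mapping.update i 0 (Poly_Mapping.update (Suc i) 0 m)"
  let ?t = "Poly_Mapping.map_key (transpose i (Suc i))"
  have m: "m = r + Poly_Mapping.single i a + Poly_Mapping.single (Suc i) b"
    by (intro poly_mapping_eqI)
      (auto simp: r_def a_def b_def lookup_update lookup_add lookup_single when_def)
  have "?t r = r"
    by (intro poly_mapping_eqI)
      (auto simp: r_def map_key.rep_eq lookup_update transpose_def)
  then have tm: "?t m = r + Poly_Mapping.single (Suc i) a + Poly_Mapping.single i b"
    by (simp add: m map_key_plus map_key_transpose_single)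
  have "Poly_Mapping.single m c = Poly_Mapping.single r c * (pvar i ^ a * pvar (Suc i) ^ b)"
    by (simp add: m pvar_power mult_single ac_simps)
  moreover have "swap_vars i (Poly_Mapping.single m c) =
      Poly_Mapping.single r c * (pvar i ^ b * pvar (Suc i) ^ a)"
    by (simp add: swap_vars_single tm pvar_power mult_single ac_simps)
  ultimately have "(pvar i - pvar (Suc i)) dvd
      (Poly_Mapping.single m c - swap_vars i (Poly_Mapping.single m c))"
    by (simp only: right_diff_distrib[symmetric]) (rule dvd_mult[OF dvd_power_swap])
  with update.IH have "(pvar i - pvar (Suc i)) dvd
      ((f - swap_vars i f) + (Poly_Mapping.single m c - swap_vars i (Poly_Mapping.single m c)))"
    by (rule dvd_add)
  then show ?case
    by (simp add: upd swap_vars_add algebra_simps)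
qed

lemma ex1_divided_difference: "\<exists>!g. f - swap_vars i f = (pvar i - pvar (Suc i)) * g"
proof -
  have "pvar i - pvar (Suc i) \<noteq> 0"
  proof
    assume "pvar i - pvar (Suc i) = 0"
    then have "Poly_Mapping.lookup (pvar i) (Poly_Mapping.single i 1) =
        Poly_Mapping.lookup (pvar (Suc i)) (Poly_Mapping.single i 1)" by simp
    moreover have "Poly_Mapping.single (Suc i) (1 :: nat) \<noteq> Poly_Mapping.single i 1"
      by (auto dest: arg_cong[where f = "\<lambda>p. Poly_Mapping.lookup p i"] simp: lookup_single)
    ultimately show False
      by (simp add: pvar_def lookup_single when_def)
  qed
  moreover obtain g where "f - swap_vars i f = (pvar i - pvar (Suc i)) * g"
    using dvd_diff_swap_vars[of i f] by (elim dvdE)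
  ultimately show ?thesis
    by (intro ex1I[of _ g]) (metis, metis mult_left_cancel)
qed

definition swap_adjacent :: "nat \<Rightarrow> 'a list \<Rightarrow> 'a list" where
  "swap_adjacent i w = w[i := w ! Suc i, Suc i := w ! i]"

definition is_ascent :: "nat list \<Rightarrow> nat \<Rightarrow> bool" where
  "is_ascent w i \<longleftrightarrow> Suc i < length w \<and> w ! i < w ! Suc i"

text \<open>The Schubert polynomial: \<open>\<SS>\<^bsub>w\<^sub>0\<^esub> = x\<^sub>1\<^bsup>n-1\<^esup> x\<^sub>2\<^bsup>n-2\<^esup> \<cdots> x\<^bsub>n-1\<^esub>\<close> for the
  longest permutation \<open>w\<^sub>0 = n \<dots> 2 1\<close> (the only one without ascents), and
  \<open>\<SS>\<^sub>w = \<partial>\<^sub>i \<SS>\<^bsub>w s\<^sub>i\<^esub>\<close> whenever \<open>w(i) < w(i+1)\<close>. As the divided differences satisfy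
  the braid relations, the choice of the ascent is immaterial; the recursion takes the first
  one. List positions count from 0, so position \<open>i\<close> goes with the variable
  \<open>x\<^bsub>i+1\<^esub>\<close>.\<close>

function schubert :: "nat list \<Rightarrow> ipoly" where
  "schubert w =
     (if \<exists>i. is_ascent w i
      then let i = (LEAST i. is_ascent w i)
           in divided_difference (Suc i) (schubert (swap_adjacent i w))
      else (\<Prod>i<length w. pvar (Suc i) ^ (length w - Suc i)))"
  by pat_completeness auto

termination
proof (relation "measure (\<lambda>w. card {(j, k). j < k \<and> k < length w \<and> w ! j < w ! k})")
  show "wf (measure (\<lambda>w. card {(j, k). j < k \<and> k < length w \<and> w ! j < w ! k}))"
    by simp
next
  fix w :: "nat list" and i
  assume "\<exists>i. is_ascent w i" and i: "i = (LEAST i. is_ascent w i)"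
  then have "is_ascent w i"
    using LeastI_ex[of "is_ascent w"] by blast
  then have asc: "Suc i < length w" "w ! i < w ! Suc i"
    unfolding is_ascent_def by blast+
  define A where "A = (\<lambda>w :: nat list. {(j, k). j < k \<and> k < length w \<and> w ! j < w ! k})"
  let ?w' = "swap_adjacent i w" and ?t = "transpose i (Suc i)"
  have nth: "?w' ! j = w ! ?t j" if "j < length w" for j
    using that asc by (auto simp: swap_adjacent_def nth_list_update transpose_def)
  have len: "length ?w' = length w"
    by (simp add: swap_adjacent_def)
  have fin: "finite (A v)" for v
    by (rule finite_subset[of _ "{..<length v} \<times> {..<length v}"]) (auto simp: A_def)
  have "map_prod ?t ?t ` A ?w' \<subseteq> A w - {(i, Suc i)}"
  proof (rule image_subsetI)
    fix p
    assume "p \<in> A ?w'"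
    moreover obtain j k where p: "p = (j, k)"
      by (cases p)
    ultimately have jk: "j < k" "k < length w" "w ! ?t j < w ! ?t k"
      by (auto simp: A_def len nth)
    then have "(j, k) \<noteq> (i, Suc i)"
      using asc by (auto simp: transpose_def)
    then have "?t j < ?t k" "?t k < length w" "(?t j, ?t k) \<noteq> (i, Suc i)"
      using jk asc by (auto simp: transpose_def split: if_splits)
    then show "map_prod ?t ?t p \<in> A w - {(i, Suc i)}"
      using jk by (auto simp: A_def p)
  qed
  then have "card (map_prod ?t ?t ` A ?w') \<le> card (A w - {(i, Suc i)})"
    using fin by (intro card_mono) auto
  also have "\<dots> < card (A w)"
    using asc fin by (intro card_Diff1_less) (auto simp: A_def)
  also have "card (map_prod ?t ?t ` A ?w') = card (A ?w')"
    by (intro card_image inj_on_subset[OF prod.inj_map]) auto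
  finally show "(?w', w) \<in>
      measure (\<lambda>w. card {(j, k). j < k \<and> k < length w \<and> w ! j < w ! k})"
    by (simp add: A_def)
qed

declare schubert.simps [simp del]

end

theory Submission
  imports Defs
begin

text \<open>Attach to position \<open>p\<close> of \<open>w\<close> the column \<open>D\<^sub>p = {i < p. w(i) > w(p)}\<close> of the Rothe
  diagram, and let \<open>C \<le> D\<^sub>p\<close> be the Gale order on finite sets of equal size. If \<open>w\<close> avoids
  1432 and 1423, then \<open>\<SS>\<^sub>w = \<Prod>\<^sub>p \<Sum>\<^bsub>C \<le> D\<^sub>p\<^esub> x\<^sup>C\<close>: exchanging the letters at the first
  ascent \<open>i\<close> preserves the avoidance, and at most one later letter lies between \<open>w(i)\<close> and
  \<open>w(i+1)\<close>, so that \<open>\<partial>\<^sub>i\<close> acts as a Demazure operator on a single factor while all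
  the other factors are symmetric in \<open>x\<^sub>i, x\<^bsub>i+1\<^esub>\<close>.

  Hence \<open>\<SS>\<^sub>w(1)\<close> counts the families \<open>(C\<^sub>p)\<close> with \<open>C\<^sub>p \<le> D\<^sub>p\<close>. For a set \<open>J\<close> of deleted
  positions, the value for the remaining subword counts the families that agree with the
  diagram in the rows and columns of \<open>J\<close>, i.e. that satisfy one condition for each
  \<open>j \<in> J\<close>. By inclusion-exclusion the alternating sum counts the families that violate
  the condition of every position outside \<open>u\<close>.\<close>

section \<open>Exchanging two variables as a ring homomorphism; divided differences\<close>

lemma swap_vars_zero [simp]: "swap_vars i 0 = 0"
  by (simp add: swap_vars_def inj_map_key_transpose)

lemma swap_vars_sum: "swap_vars i (sum f A) = (\<Sum>a\<in>A. swap_vars i (f a))"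
  by (induction A rule: infinite_finite_induct) (auto simp: swap_vars_add)

lemma swap_vars_one [simp]: "swap_vars i 1 = 1"
  by (simp add: swap_vars_single flip: single_one)

lemma sum_single_keys:
  "(\<Sum>k\<in>Poly_Mapping.keys f. Poly_Mapping.single k (Poly_Mapping.lookup f k)) = f"
  by (rule poly_mapping_eqI)
    (auto simp: lookup_sum lookup_single when_def in_keys_iff)

text \<open>Splitting both factors into monomials reduces multiplicativity of
  \<open>swap_vars\<close> and of evaluation to single monomials.\<close>

lemma poly_mapping_mult_eq_sum:
  "f * g = (\<Sum>k\<in>Poly_Mapping.keys f. \<Sum>l\<in>Poly_Mapping.keys g. Poly_Mapping.single k (Poly_Mapping.lookup f k) * Poly_Mapping.single l (Poly_Mapping.lookup g l))"
  for f g :: ipoly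
proof -
  have "f * g = (\<Sum>k\<in>Poly_Mapping.keys f. Poly_Mapping.single k (Poly_Mapping.lookup f k)) * (\<Sum>l\<in>Poly_Mapping.keys g. Poly_Mapping.single l (Poly_Mapping.lookup g l))"
    by (simp only: sum_single_keys)
  then show ?thesis
    by (simp add: sum_product)
qed

lemma swap_vars_mult: "swap_vars i (f * g) = swap_vars i f * swap_vars i g"
proof -
  let ?s = "swap_vars i"
  have "?s (f * g) = (\<Sum>k\<in>Poly_Mapping.keys f. \<Sum>l\<in>Poly_Mapping.keys g. ?s (Poly_Mapping.single k (Poly_Mapping.lookup f k)) * ?s (Poly_Mapping.single l (Poly_Mapping.lookup g l)))"
    by (simp add: poly_mapping_mult_eq_sum[of f g] swap_vars_sum mult_single swap_vars_single
        map_key_plus)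
  also have "\<dots> = ?s (\<Sum>k\<in>Poly_Mapping.keys f. Poly_Mapping.single k (Poly_Mapping.lookup f k)) * ?s (\<Sum>l\<in>Poly_Mapping.keys g. Poly_Mapping.single l (Poly_Mapping.lookup g l))"
    by (simp only: swap_vars_sum sum_product)
  finally show ?thesis
    by (simp only: sum_single_keys)
qed

lemma swap_vars_prod: "swap_vars i (prod f A) = (\<Prod>a\<in>A. swap_vars i (f a))"
  by (induction A rule: infinite_finite_induct) (auto simp: swap_vars_mult)

lemma swap_vars_pvar: "swap_vars i (pvar k) = pvar (transpose i (Suc i) k)"
  by (simp add: pvar_def swap_vars_single map_key_transpose_single)

lemma divided_difference_eqI:
  assumes "f - swap_vars i f = (pvar i - pvar (Suc i)) * g"
  shows "divided_difference i f = g"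
  unfolding divided_difference_def
  using ex1_divided_difference assms by (rule the1_equality)

section \<open>Evaluation at ones as a ring homomorphism\<close>

lemma poly_eval_one: "poly_eval (\<lambda>_. 1) f = (\<Sum>m\<in>Poly_Mapping.keys f. Poly_Mapping.lookup f m)"
  by (simp add: poly_eval_def)

lemma poly_eval_one_add:
  "poly_eval (\<lambda>_. 1) (f + g) = poly_eval (\<lambda>_. 1) f + poly_eval (\<lambda>_. 1) g"
proof -
  \<comment> \<open>Cancellation can shrink the support of a sum, so all three evaluations are taken
    over one common set of exponents.\<close>
  have *: "poly_eval (\<lambda>_. 1) h = (\<Sum>m\<in>Poly_Mapping.keys f \<union> Poly_Mapping.keys g. Poly_Mapping.lookup h m)"
    if "Poly_Mapping.keys h \<subseteq> Poly_Mapping.keys f \<union> Poly_Mapping.keys g" for h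
    unfolding poly_eval_one using that
    by (intro sum.mono_neutral_left) (auto simp: in_keys_iff)
  show ?thesis
    using keys_add[of f g] by (simp add: * lookup_add sum.distrib)
qed

lemma poly_eval_one_single [simp]: "poly_eval (\<lambda>_. 1) (Poly_Mapping.single m c) = c"
  by (simp add: poly_eval_one)

lemma poly_eval_one_sum:
  "poly_eval (\<lambda>_. 1) (sum f A) = (\<Sum>a\<in>A. poly_eval (\<lambda>_. 1) (f a))"
  by (induction A rule: infinite_finite_induct)
    (auto simp: poly_eval_one_add, auto simp: poly_eval_one)

lemma poly_eval_one_mult:
  "poly_eval (\<lambda>_. 1) (f * g) = poly_eval (\<lambda>_. 1) f * poly_eval (\<lambda>_. 1) g"
  unfolding poly_mapping_mult_eq_sum[of f g]
  by (simp only: poly_eval_one_sum mult_single poly_eval_one_single)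
    (simp add: poly_eval_one sum_product)

lemma poly_eval_one_prod:
  "poly_eval (\<lambda>_. 1) (prod f A) = (\<Prod>a\<in>A. poly_eval (\<lambda>_. 1) (f a))"
  by (induction A rule: infinite_finite_induct)
    (auto simp: poly_eval_one_mult simp flip: single_one)

lemma poly_eval_one_pvar: "poly_eval (\<lambda>_. 1) (pvar i) = 1"
  by (simp add: pvar_def)

section \<open>Gale order and its generating polynomials\<close>

text \<open>The lower interval of \<open>D\<close> in the Gale order. For finite sets the counting
  condition says that the k-th smallest element of \<open>C\<close> is at most that of
  \<open>D\<close>. The ground set is a parameter because deleting positions also deletes
  rows.\<close>

definition gale :: "nat set \<Rightarrow> nat set \<Rightarrow> nat set set" where
  "gale I D = {C. C \<subseteq> I \<and> card C = card D \<and>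
     (\<forall>t. card (D \<inter> {..<t}) \<le> card (C \<inter> {..<t}))}"

lemma finite_gale: "finite I \<Longrightarrow> finite (gale I D)"
  by (rule finite_subset[of _ "Pow I"]) (auto simp: gale_def)

lemma card_Int_lessThan_Suc:
  "card (C \<inter> {..<Suc i}) = card (C \<inter> {..<i}) + (if i \<in> C then 1 else 0)" for C :: "nat set"
proof (cases "i \<in> C")
  case True
  then have "C \<inter> {..<Suc i} = insert i (C \<inter> {..<i})" by auto
  with True show ?thesis by simp
next
  case False
  then have "C \<inter> {..<Suc i} = C \<inter> {..<i}" by (auto simp: less_Suc_eq)
  with False show ?thesis by simp
qed

text \<open>Every threshold other than \<open>Suc i\<close> has \<open>i\<close> and
  \<open>Suc i\<close> on the same side.\<close>

lemma transpose_image_Int_lessThan: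
  assumes "t \<noteq> Suc i"
  shows "transpose i (Suc i) ` C \<inter> {..<t} = transpose i (Suc i) ` (C \<inter> {..<t})"
  using assms by (auto simp: transpose_def image_iff split: if_splits)

lemma card_transpose_image_Int_lessThan:
  assumes "t \<noteq> Suc i"
  shows "card (transpose i (Suc i) ` C \<inter> {..<t}) = card (C \<inter> {..<t})"
  by (simp add: transpose_image_Int_lessThan[OF assms] card_image inj_on_subset[OF inj_transpose])

lemma transpose_image_mem_iff: "k \<in> transpose i j ` C \<longleftrightarrow> transpose i j k \<in> C"
  by (metis image_iff transpose_involutory)

text \<open>Only the count at \<open>Suc i\<close> changes. If \<open>i\<close> is not in
  \<open>D\<close>, the condition there follows from the one at \<open>i\<close>; if both
  \<open>i\<close> and \<open>Suc i\<close> are in \<open>D\<close>, it follows from the one at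
  \<open>Suc (Suc i)\<close>.\<close>

lemma transpose_image_in_gale:
  assumes "C \<in> gale {..<n} D" "Suc i < n" "i \<in> D \<Longrightarrow> Suc i \<in> D"
  shows "transpose i (Suc i) ` C \<in> gale {..<n} D"
proof -
  let ?t = "transpose i (Suc i)"
  from assms(1) have C: "C \<subseteq> {..<n}" "card C = card D"
    "\<And>t. card (D \<inter> {..<t}) \<le> card (C \<inter> {..<t})"
    by (auto simp: gale_def)
  have "?t ` C \<subseteq> {..<n}"
    using C(1) assms(2) by (auto simp: transpose_def)
  moreover have "card (?t ` C) = card D"
    by (simp add: C(2) card_image inj_on_subset[OF inj_transpose])
  moreover have "card (D \<inter> {..<t}) \<le> card (?t ` C \<inter> {..<t})" for t
  proof (cases "t = Suc i")
    case True
    have "card (D \<inter> {..<i}) \<le> card (?t ` C \<inter> {..<i})"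
      "card (D \<inter> {..<Suc (Suc i)}) \<le> card (?t ` C \<inter> {..<Suc (Suc i)})"
      using C(3) by (simp_all add: card_transpose_image_Int_lessThan)
    with assms(3) show ?thesis
      by (auto simp: True card_Int_lessThan_Suc split: if_splits)
  next
    case False
    then show ?thesis
      using C(3) by (simp add: card_transpose_image_Int_lessThan)
  qed
  ultimately show ?thesis
    by (simp add: gale_def)
qed

definition mono_of :: "nat set \<Rightarrow> ipoly" where
  "mono_of C = (\<Prod>k\<in>C. pvar (Suc k))"

text \<open>For \<open>D\<close> inside \<open>{..<n}\<close> this is the key polynomial of the
  indicator vector of \<open>D\<close>, or the basis generating polynomial of a Schubert
  matroid.\<close>

definition gale_poly :: "nat \<Rightarrow> nat set \<Rightarrow> ipoly" where
  "gale_poly n D = (\<Sum>C\<in>gale {..<n} D. mono_of C)"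

lemma swap_vars_mono_of: "swap_vars (Suc i) (mono_of C) = mono_of (transpose i (Suc i) ` C)"
proof -
  have "transpose (Suc i) (Suc (Suc i)) (Suc k) = Suc (transpose i (Suc i) k)" for k
    by (simp add: transpose_def)
  then show ?thesis
    by (simp add: mono_of_def swap_vars_prod swap_vars_pvar prod.reindex
        inj_on_subset[OF inj_transpose])
qed

lemma swap_vars_gale_poly:
  assumes "Suc i < n" "i \<in> D \<Longrightarrow> Suc i \<in> D"
  shows "swap_vars (Suc i) (gale_poly n D) = gale_poly n D"
  unfolding gale_poly_def swap_vars_sum swap_vars_mono_of
  using assms
  by (intro sum.reindex_bij_witness[where i = "(`) (transpose i (Suc i))" and j = "(`) (transpose i (Suc i))"])
    (auto simp: transpose_image_in_gale image_comp)

text \<open>The Demazure operator with its denominator cleared. Moving \<open>i\<close> to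
  \<open>Suc i\<close> in \<open>D\<close> enlarges the Gale interval by the family
  \<open>M\<close>. The polynomial of the larger interval is symmetric in the two variables, and the
  operator annihilates the part that belongs to \<open>M\<close>.\<close>

lemma gale_poly_demazure:
  fixes i n :: nat
  defines "\<tau> \<equiv> transpose i (Suc i)"
  assumes "Suc i < n" "i \<in> D" "Suc i \<notin> D"
  shows "pvar (Suc i) * gale_poly n D - pvar (Suc (Suc i)) * swap_vars (Suc i) (gale_poly n D) =
    (pvar (Suc i) - pvar (Suc (Suc i))) * gale_poly n (\<tau> ` D)"
proof -
  define M where "M = gale {..<n} (\<tau> ` D) - gale {..<n} D"
  have mem: "i \<notin> \<tau> ` D" "Suc i \<in> \<tau> ` D"
    using assms by (auto simp: transpose_image_mem_iff)
  have cD: "card (\<tau> ` D \<inter> {..<t}) = card (D \<inter> {..<t})" if "t \<noteq> Suc i" for t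
    unfolding \<tau>_def using that by (rule card_transpose_image_Int_lessThan)
  have cle: "card (\<tau> ` D \<inter> {..<t}) \<le> card (D \<inter> {..<t})" for t
    using cD[of t] cD[of i] assms(3) mem(1)
    by (cases "t = Suc i") (auto simp: card_Int_lessThan_Suc)
  have card: "card (\<tau> ` D) = card D"
    by (simp add: \<tau>_def card_image inj_on_subset[OF inj_transpose])
  have sub: "gale {..<n} D \<subseteq> gale {..<n} (\<tau> ` D)"
    using cle card by (auto simp: gale_def intro: order_trans)
  have fin: "finite (gale {..<n} (\<tau> ` D))"
    by (simp add: finite_gale)
  text \<open>By this, \<open>x\<^sub>i x\<^sup>C\<close> is symmetric in \<open>x\<^sub>i, x\<^bsub>i+1\<^esub>\<close> for each set \<open>C\<close> in which the two
    generating functions differ.\<close>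
  have M: "i \<notin> C \<and> Suc i \<in> C" if C: "C \<in> M" for C
  proof -
    from C obtain t where t: "\<not> card (D \<inter> {..<t}) \<le> card (C \<inter> {..<t})"
      by (auto simp: M_def gale_def card)
    have le: "card (\<tau> ` D \<inter> {..<t}) \<le> card (C \<inter> {..<t})" for t
      using C by (auto simp: M_def gale_def)
    have "t = Suc i"
      using t le[of t] cD[of t] by fastforce
    then show ?thesis
      using t le[of i] le[of "Suc (Suc i)"] cD[of i] cD[of "Suc (Suc i)"] assms(3,4)
      by (auto simp: card_Int_lessThan_Suc split: if_splits)
  qed
  have F: "gale_poly n D = gale_poly n (\<tau> ` D) - (\<Sum>C\<in>M. mono_of C)"
    using sum_diff[OF fin sub, of mono_of] by (simp add: gale_poly_def M_def)
  have symF: "swap_vars (Suc i) (gale_poly n (\<tau> ` D)) = gale_poly n (\<tau> ` D)"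
    using assms(2) mem by (intro swap_vars_gale_poly) auto
  have "finite C" if "C \<in> M" for C
    using that by (auto simp: M_def gale_def intro: finite_subset)
  then have "pvar (Suc (Suc i)) * swap_vars (Suc i) (mono_of C) = pvar (Suc i) * mono_of C"
    if "C \<in> M" for C
  proof -
    define B where "B = C - {Suc i}"
    have B: "C = insert (Suc i) B" "Suc i \<notin> B" "i \<notin> B" "finite B"
      using M[OF that] \<open>\<And>C. C \<in> M \<Longrightarrow> finite C\<close>[OF that] by (auto simp: B_def)
    have "transpose i (Suc i) ` B = (\<lambda>x. x) ` B"
      using B by (intro image_cong) (auto simp: transpose_def)
    then have "swap_vars (Suc i) (mono_of C) = mono_of (insert i B)"
      by (simp add: swap_vars_mono_of B(1))
    with B show ?thesis
      by (simp add: mono_of_def)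
  qed
  then have "pvar (Suc (Suc i)) * swap_vars (Suc i) (\<Sum>C\<in>M. mono_of C) = pvar (Suc i) * (\<Sum>C\<in>M. mono_of C)"
    by (simp add: swap_vars_sum sum_distrib_left)
  moreover have "swap_vars (Suc i) (gale_poly n D) + swap_vars (Suc i) (\<Sum>C\<in>M. mono_of C) = gale_poly n (\<tau> ` D)"
    by (simp add: F symF flip: swap_vars_add)
  then have "swap_vars (Suc i) (gale_poly n D) = gale_poly n (\<tau> ` D) - swap_vars (Suc i) (\<Sum>C\<in>M. mono_of C)"
    by (simp add: eq_diff_eq)
  ultimately show ?thesis
    by (simp add: F right_diff_distrib left_diff_distrib)
qed

text \<open>An initial segment is the least element of the Gale order, so full columns contribute
  single monomials.\<close>

lemma gale_lessThan:
  assumes "p \<le> n"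
  shows "gale {..<n} {..<p} = {{..<p}}"
proof
  show "gale {..<n} {..<p} \<subseteq> {{..<p}}"
  proof
    fix C
    assume C: "C \<in> gale {..<n} {..<p}"
    then have fin: "finite C" and cd: "card C = p"
      by (auto simp: gale_def intro: finite_subset)
    have "card ({..<p} \<inter> {..<p}) \<le> card (C \<inter> {..<p})"
      using C unfolding gale_def by blast
    then have "C \<inter> {..<p} = {..<p}"
      by (intro card_seteq) auto
    then have "{..<p} = C"
      using fin cd by (intro card_seteq) auto
    then show "C \<in> {{..<p}}" by simp
  qed
qed (use assms in \<open>auto simp: gale_def\<close>)

lemma gale_poly_lessThan: "p \<le> n \<Longrightarrow> gale_poly n {..<p} = mono_of {..<p}"
  by (simp add: gale_poly_def gale_lessThan)

lemma poly_eval_one_gale_poly: "poly_eval (\<lambda>_. 1) (gale_poly n D) = int (card (gale {..<n} D))"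
  by (simp add: gale_poly_def mono_of_def poly_eval_one_sum poly_eval_one_prod poly_eval_one_pvar)

section \<open>Rothe columns and the product formula for Schubert polynomials\<close>

text \<open>The column of the Rothe diagram that belongs to the letter at position \<open>p\<close>.\<close>

definition rothe_column :: "nat list \<Rightarrow> nat \<Rightarrow> nat set" where
  "rothe_column w p = {i. i < p \<and> w ! p < w ! i}"

text \<open>Joint avoidance of 1432 and 1423, the positions \<open>p, q\<close> being those of 1 and 4.\<close>

definition thin :: "nat list \<Rightarrow> bool" where
  "thin w \<longleftrightarrow> distinct w \<and>
     (\<forall>p q r s. p < q \<longrightarrow> q < r \<longrightarrow> q < s \<longrightarrow> r < length w \<longrightarrow> s < length w \<longrightarrow>
        w ! p < w ! r \<longrightarrow> w ! r < w ! q \<longrightarrow> w ! p < w ! s \<longrightarrow> w ! s < w ! q \<longrightarrow> r = s)"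

lemma thinD:
  assumes "thin w" "p < q" "q < r" "q < s" "r < length w" "s < length w"
    "w ! p < w ! r" "w ! r < w ! q" "w ! p < w ! s" "w ! s < w ! q"
  shows "r = s"
  using assms unfolding thin_def by blast

text \<open>Used at the first ascent and for words without ascents: there the columns in question
  are full.\<close>

lemma nth_decreasing:
  fixes w :: "nat list"
  assumes "distinct w" "\<And>k. k < i \<Longrightarrow> \<not> is_ascent w k" "i < length w" "p < q" "q \<le> i"
  shows "w ! q < w ! p"
  using \<open>p < q\<close> \<open>q \<le> i\<close>
proof (induction q)
  case (Suc q)
  have "\<not> w ! q < w ! Suc q" "w ! q \<noteq> w ! Suc q"
    using assms(1,3) assms(2)[of q] Suc.prems by (auto simp: is_ascent_def nth_eq_iff_index_eq)
  then have "w ! Suc q < w ! q" by simp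
  with Suc show ?case
    by (cases "p = q") auto
qed simp

text \<open>The boxes of a staircase, counted by columns on the left and by rows on the
  right.\<close>

lemma prod_staircase:
  "(\<Prod>p<n. \<Prod>k<p. f k) = (\<Prod>k<n. f k ^ (n - Suc k))" for f :: "nat \<Rightarrow> 'a :: comm_monoid_mult"
proof (induction n)
  case (Suc n)
  have "(\<Prod>k<n. f k ^ (n - k)) = (\<Prod>k<n. f k ^ (n - Suc k) * f k)"
    by (intro prod.cong) (auto simp: Suc_diff_Suc simp flip: power_Suc2)
  then show ?case
    by (simp add: Suc prod.distrib)
qed simp

text \<open>The induction step of the product formula. A forbidden configuration in the exchanged
  word pulls back along the transposition to one in \<open>w\<close>. In the product, all factors
  are symmetric in the two variables except one variable and at most one column polynomial.\<close>

lemma swap_adjacent_first_ascent: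
  assumes w: "thin w" and asc: "is_ascent w i" and first: "\<And>k. k < i \<Longrightarrow> \<not> is_ascent w k"
  shows "thin (swap_adjacent i w)"
    and "divided_difference (Suc i) (\<Prod>p<length w. gale_poly (length w) (rothe_column (swap_adjacent i w) p)) =
      (\<Prod>p<length w. gale_poly (length w) (rothe_column w p))"
proof -
  define n where "n = length w"
  define \<tau> where "\<tau> = transpose i (Suc i)"
  define v where "v = swap_adjacent i w"
  have asc': "Suc i < n" "w ! i < w ! Suc i"
    using asc by (auto simp: is_ascent_def n_def)
  have dist: "distinct w"
    using w by (simp add: thin_def)
  have len: "length v = n"
    by (simp add: v_def swap_adjacent_def n_def)
  have nth: "v ! j = w ! \<tau> j" if "j < n" for j
    using that asc' by (auto simp: v_def \<tau>_def n_def swap_adjacent_def nth_list_update transpose_def)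
  have \<tau>n: "\<tau> j < n \<longleftrightarrow> j < n" for j
    using asc' by (auto simp: \<tau>_def transpose_def)
  have \<tau>less: "\<tau> j < \<tau> k" if "j < k" "\<not> (j = i \<and> k = Suc i)" for j k
    using that by (auto simp: \<tau>_def transpose_def)
  have dec: "w ! i < w ! k" if "k < i" for k
    using nth_decreasing[OF dist first, of i k i] that asc' by (simp add: n_def)
  have "distinct v"
    using dist asc' by (simp add: v_def swap_adjacent_def n_def distinct_swap)
  moreover have "r = s"
    if *: "p < q" "q < r" "q < s" "r < n" "s < n"
      "v ! p < v ! r" "v ! r < v ! q" "v ! p < v ! s" "v ! s < v ! q" for p q r s
  proof -
    have v: "v ! p = w ! \<tau> p" "v ! q = w ! \<tau> q" "v ! r = w ! \<tau> r" "v ! s = w ! \<tau> s"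
      using * by (auto intro!: nth)
    \<comment> \<open>The order could only be reversed for \<open>p = i\<close> and
      \<open>q = Suc i\<close>, but the exchanged word descends there.\<close>
    have "\<tau> p < \<tau> q"
      using * asc' v by (intro \<tau>less) (auto simp: \<tau>_def)
    \<comment> \<open>In the exceptional case the letter at \<open>x\<close> is
      \<open>w ! i\<close>, and all letters before position \<open>i\<close> are larger, so none of
      them can play the role of 1.\<close>
    moreover have "\<tau> q < \<tau> x" if "x \<in> {r, s}" for x
    proof (intro \<tau>less notI)
      assume x: "q = i \<and> x = Suc i"
      then have "w ! \<tau> p < w ! i"
        using that * v by (auto simp: \<tau>_def)
      moreover have "\<tau> p = p" "p < i"
        using x *(1) by (auto simp: \<tau>_def transpose_def)
      ultimately show False
        using dec[of p] by simp
    qed (use that * in auto)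
    ultimately have "\<tau> r = \<tau> s"
      using w * by (intro thinD[of w "\<tau> p" "\<tau> q"]) (auto simp: v \<tau>n simp flip: n_def)
    then show ?thesis
      unfolding \<tau>_def by (rule injD[OF inj_transpose])
  qed
  ultimately show "thin (swap_adjacent i w)"
    unfolding thin_def len v_def[symmetric] by blast

  let ?x = "pvar (Suc i)" and ?y = "pvar (Suc (Suc i))" and ?s = "swap_vars (Suc i)"
  \<comment> \<open>The later columns that contain \<open>Suc i\<close> but not \<open>i\<close>;
    these are the ones that are not symmetric.\<close>
  define R where "R = {p. Suc i < p \<and> p < n \<and> w ! i < w ! p \<and> w ! p < w ! Suc i}"
  define S where "S = {..<n} - {i, Suc i} - R"
  define P where "P = mono_of {..<i} * gale_poly n (rothe_column w (Suc i)) *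
    (\<Prod>p\<in>S. gale_poly n (rothe_column w p))"
  have split: "(\<Prod>p<n. f p) = f i * f (Suc i) * (\<Prod>p\<in>R. f p) * (\<Prod>p\<in>S. f p)" for f :: "nat \<Rightarrow> ipoly"
  proof -
    have "{..<n} = {i, Suc i} \<union> (R \<union> S)"
      using asc' by (auto simp: R_def S_def)
    moreover have "finite R" "finite S" "R \<inter> S = {}" "{i, Suc i} \<inter> (R \<union> S) = {}"
      by (auto simp: R_def S_def)
    ultimately show ?thesis
      by (simp add: prod.union_disjoint mult.assoc)
  qed
  have col_i: "rothe_column w i = {..<i}" "rothe_column v (Suc i) = {..<Suc i}"
    using dec asc' by (auto simp: rothe_column_def nth \<tau>_def less_Suc_eq transpose_def)
  have col_Suc: "rothe_column v i = rothe_column w (Suc i)"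
    using asc' by (auto simp: rothe_column_def nth \<tau>_def less_Suc_eq transpose_def)
  have col_gt: "rothe_column v p = \<tau> ` rothe_column w p" if "Suc i < p" "p < n" for p
  proof -
    have \<tau>p: "\<tau> k < p \<longleftrightarrow> k < p" "\<tau> p = p" for k
      using that by (auto simp: \<tau>_def transpose_def)
    have "k \<in> rothe_column v p \<longleftrightarrow> \<tau> k \<in> rothe_column w p" for k
      using that by (cases "k < p") (simp_all add: rothe_column_def nth \<tau>p)
    then show ?thesis
      by (simp add: set_eq_iff \<tau>_def transpose_image_mem_iff)
  qed
  have col_S: "rothe_column v p = rothe_column w p"
    "i \<in> rothe_column w p \<Longrightarrow> Suc i \<in> rothe_column w p" if "p \<in> S" for p
  proof -
    have p: "p < n" "p \<noteq> i" "p \<noteq> Suc i" "p \<notin> R"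
      using that by (auto simp: S_def)
    consider "p < i" | "Suc i < p"
      using p by linarith
    then have "rothe_column v p = rothe_column w p \<and> (i \<in> rothe_column w p \<longrightarrow> Suc i \<in> rothe_column w p)"
    proof cases
      case 1
      then show ?thesis
        using p by (auto simp: rothe_column_def nth \<tau>_def transpose_def)
    next
      case 2
      have "w ! i \<noteq> w ! p" "w ! Suc i \<noteq> w ! p"
        using p dist asc' by (simp_all add: nth_eq_iff_index_eq n_def)
      \<comment> \<open>Outside \<open>R\<close> the letter \<open>w ! p\<close> is not between the
        two exchanged letters, so the column contains both rows or neither.\<close>
      then have iff: "i \<in> rothe_column w p \<longleftrightarrow> Suc i \<in> rothe_column w p"
        using p 2 asc' by (auto simp: rothe_column_def R_def)
      then have "\<tau> ` rothe_column w p = rothe_column w p"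
        by (intro set_eqI, unfold \<tau>_def transpose_image_mem_iff) (auto simp: transpose_def)
      with 2 p iff show ?thesis
        by (simp add: col_gt)
    qed
    then show "rothe_column v p = rothe_column w p"
      "i \<in> rothe_column w p \<Longrightarrow> Suc i \<in> rothe_column w p"
      by blast+
  qed
  \<comment> \<open>The full column at \<open>Suc i\<close> exceeds \<open>{..<i}\<close> by the row
    \<open>i\<close>. Its variable \<open>?x\<close> is what turns the divided difference into a
    Demazure operator.\<close>
  have prod_v: "(\<Prod>p<n. gale_poly n (rothe_column v p)) = P * (?x * (\<Prod>p\<in>R. gale_poly n (rothe_column v p)))"
    using asc' by (simp add: split col_i col_Suc col_S gale_poly_lessThan P_def)
      (simp add: mono_of_def lessThan_Suc ac_simps)
  have prod_w: "(\<Prod>p<n. gale_poly n (rothe_column w p)) = P * (\<Prod>p\<in>R. gale_poly n (rothe_column w p))"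
    using asc' by (simp add: split col_i gale_poly_lessThan P_def ac_simps)
  have symP: "?s P = P"
  proof -
    have "transpose i (Suc i) ` {..<i} = (\<lambda>x. x) ` {..<i}"
      by (intro image_cong) (auto simp: transpose_def)
    then have "?s (mono_of {..<i}) = mono_of {..<i}"
      by (simp add: swap_vars_mono_of)
    moreover have "?s (gale_poly n (rothe_column w (Suc i))) = gale_poly n (rothe_column w (Suc i))"
      using asc' by (intro swap_vars_gale_poly) (auto simp: rothe_column_def)
    moreover have "?s (gale_poly n (rothe_column w p)) = gale_poly n (rothe_column w p)" if "p \<in> S" for p
      using that asc' col_S(2) by (intro swap_vars_gale_poly) auto
    ultimately show ?thesis
      by (simp add: P_def swap_vars_mult swap_vars_prod)
  qed
  have sR: "?x * (\<Prod>p\<in>R. gale_poly n (rothe_column v p)) -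
      ?y * ?s (\<Prod>p\<in>R. gale_poly n (rothe_column v p)) = (?x - ?y) * (\<Prod>p\<in>R. gale_poly n (rothe_column w p))"
  proof (cases "R = {}")
    case False
    then obtain c where c: "c \<in> R" by blast
    \<comment> \<open>Thinness, with \<open>i\<close> as the position of 1 and \<open>Suc i\<close>
      as that of 4, leaves at most one element in \<open>R\<close>.\<close>
    have "p = c" if "p \<in> R" for p
      using w that c asc' by (intro thinD[of w i "Suc i"]) (auto simp: R_def n_def)
    with c have R: "R = {c}" by blast
    have c': "Suc i < c" "c < n" "w ! i < w ! c" "w ! c < w ! Suc i"
      using c by (auto simp: R_def)
    have "\<tau> ` rothe_column v c = rothe_column w c"
      using c' by (simp add: col_gt \<tau>_def image_comp)
    moreover have "i \<in> rothe_column v c" "Suc i \<notin> rothe_column v c"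
      using c' by (auto simp: col_gt \<tau>_def transpose_image_mem_iff) (auto simp: rothe_column_def)
    ultimately show ?thesis
      using gale_poly_demazure[of i n "rothe_column v c"] asc' by (simp add: R \<tau>_def)
  qed simp
  have "divided_difference (Suc i) (\<Prod>p<n. gale_poly n (rothe_column v p)) = (\<Prod>p<n. gale_poly n (rothe_column w p))"
  proof (rule divided_difference_eqI)
    have "?s (\<Prod>p<n. gale_poly n (rothe_column v p)) =
        P * (?y * ?s (\<Prod>p\<in>R. gale_poly n (rothe_column v p)))"
      by (simp only: prod_v swap_vars_mult symP swap_vars_pvar transpose_apply_first)
    then show "(\<Prod>p<n. gale_poly n (rothe_column v p)) - ?s (\<Prod>p<n. gale_poly n (rothe_column v p)) =
        (?x - ?y) * (\<Prod>p<n. gale_poly n (rothe_column w p))"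
      by (simp only: prod_v prod_w mult.left_commute[of "?x - ?y"] flip: sR right_diff_distrib)
  qed
  then show "divided_difference (Suc i) (\<Prod>p<length w. gale_poly (length w) (rothe_column (swap_adjacent i w) p)) =
      (\<Prod>p<length w. gale_poly (length w) (rothe_column w p))"
    by (simp add: n_def v_def)
qed

text \<open>Induction along the recursion of \<open>schubert\<close>. Without ascents the word is
  decreasing, every column is full and the product is the staircase monomial.\<close>

theorem schubert_thin:
  "thin w \<Longrightarrow> schubert w = (\<Prod>p<length w. gale_poly (length w) (rothe_column w p))"
proof (induction w rule: schubert.induct)
  case (1 w)
  show ?case
  proof (cases "\<exists>i. is_ascent w i")
    case True
    define i where "i = (LEAST i. is_ascent w i)"
    have i: "is_ascent w i" "\<And>k. k < i \<Longrightarrow> \<not> is_ascent w k"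
      using True unfolding i_def by (auto intro: LeastI_ex dest: not_less_Least)
    note sw = swap_adjacent_first_ascent[OF "1.prems" i]
    have "schubert w = divided_difference (Suc i) (schubert (swap_adjacent i w))"
      using True by (simp add: schubert.simps[of w] i_def Let_def)
    also have "schubert (swap_adjacent i w) =
        (\<Prod>p<length w. gale_poly (length w) (rothe_column (swap_adjacent i w) p))"
      using "1.IH"[OF True i_def sw(1)] by (simp add: swap_adjacent_def)
    finally show ?thesis
      by (simp add: sw(2))
  next
    case False
    have "rothe_column w p = {..<p}" if "p < length w" for p
      using nth_decreasing[of w p _ p] False that "1.prems" by (auto simp: rothe_column_def thin_def)
    then have "(\<Prod>p<length w. gale_poly (length w) (rothe_column w p)) = (\<Prod>p<length w. \<Prod>k<p. pvar (Suc k))"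
      by (intro prod.cong) (auto simp: gale_poly_lessThan mono_of_def)
    also have "\<dots> = schubert w"
      unfolding prod_staircase schubert.simps[of w] if_not_P[OF False] ..
    finally show ?thesis by simp
  qed
qed


section \<open>Counting Gale intervals under relabelling and restriction\<close>

text \<open>A form that refers only to the order on \<open>I\<close> and can thus be transported
  along monotone maps. Any threshold may be replaced by the largest element of \<open>I\<close>
  below it.\<close>

lemma gale_eq_closed:
  assumes "finite I" "D \<subseteq> I"
  shows "gale I D = {C. C \<subseteq> I \<and> card C = card D \<and>
    (\<forall>t\<in>I. card {d\<in>D. d \<le> t} \<le> card {c\<in>C. c \<le> t})}"
proof -
  have "(\<forall>t. card (D \<inter> {..<t}) \<le> card (C \<inter> {..<t})) \<longleftrightarrow>
      (\<forall>t\<in>I. card {d\<in>D. d \<le> t} \<le> card {c\<in>C. c \<le> t})" if C: "C \<subseteq> I" for C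
  proof (intro iffI allI ballI)
    fix t
    assume "\<forall>t. card (D \<inter> {..<t}) \<le> card (C \<inter> {..<t})"
    then have "card (D \<inter> {..<Suc t}) \<le> card (C \<inter> {..<Suc t})" by blast
    moreover have "X \<inter> {..<Suc t} = {x \<in> X. x \<le> t}" for X by auto
    ultimately show "card {d\<in>D. d \<le> t} \<le> card {c\<in>C. c \<le> t}" by simp
  next
    fix t
    assume *: "\<forall>t\<in>I. card {d\<in>D. d \<le> t} \<le> card {c\<in>C. c \<le> t}"
    show "card (D \<inter> {..<t}) \<le> card (C \<inter> {..<t})"
    proof (cases "I \<inter> {..<t} = {}")
      case True
      then have "D \<inter> {..<t} = {}" using assms(2) by blast
      then show ?thesis by simp
    next
      case False
      define m where "m = Max (I \<inter> {..<t})"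
      have "m \<in> I \<inter> {..<t}"
        using False assms(1) unfolding m_def by (intro Max_in) auto
      moreover have "x \<le> m" if "x \<in> I" "x < t" for x
        using that assms(1) by (simp add: m_def)
      ultimately have "X \<inter> {..<t} = {x \<in> X. x \<le> m}" if "X \<subseteq> I" for X
        using that by fastforce
      moreover have "m \<in> I" using \<open>m \<in> I \<inter> {..<t}\<close> by simp
      ultimately show ?thesis
        using * C assms(2) by simp
    qed
  qed
  then show ?thesis
    unfolding gale_def by blast
qed

text \<open>Transfers counts from the positions within a subword to the positions that its letters
  occupy in \<open>w\<close>.\<close>

lemma card_gale_image:
  assumes e: "strict_mono_on I e" and fin: "finite I" and D: "D \<subseteq> I"
  shows "card (gale (e ` I) (e ` D)) = card (gale I D)"
proof -
  have inj: "inj_on e I"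
    using e by (rule strict_mono_on_imp_inj_on)
  have card: "card (e ` X) = card X" if "X \<subseteq> I" for X
    using that inj by (meson card_image inj_on_subset)
  have le: "card {y \<in> e ` X. y \<le> e t} = card {x \<in> X. x \<le> t}" if "X \<subseteq> I" "t \<in> I" for X t
  proof -
    have "{y \<in> e ` X. y \<le> e t} = e ` {x \<in> X. x \<le> t}"
      using that strict_mono_on_leD[OF e] strict_mono_onD[OF e] by (fastforce simp: not_less[symmetric])
    also have "card \<dots> = card {x \<in> X. x \<le> t}"
      using that by (intro card) auto
    finally show ?thesis .
  qed
  have iff: "e ` C \<in> gale (e ` I) (e ` D) \<longleftrightarrow> C \<in> gale I D" if "C \<subseteq> I" for C
    using that fin D by (simp add: gale_eq_closed image_mono card le)
  have "gale (e ` I) (e ` D) = (`) e ` gale I D"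
  proof
    show "(`) e ` gale I D \<subseteq> gale (e ` I) (e ` D)"
      using iff by (auto simp: gale_def)
    show "gale (e ` I) (e ` D) \<subseteq> (`) e ` gale I D"
    proof
      fix C
      assume C: "C \<in> gale (e ` I) (e ` D)"
      then obtain B where "B \<subseteq> I" "C = e ` B"
        by (auto simp: gale_def subset_image_iff)
      with C iff show "C \<in> (`) e ` gale I D" by blast
    qed
  qed
  moreover have "inj_on ((`) e) (gale I D)"
    using inj by (rule inj_on_subset[OF inj_on_image_Pow]) (auto simp: gale_def)
  ultimately show ?thesis
    by (simp add: card_image)
qed

text \<open>Where \<open>C\<close> and \<open>D\<close> agree outside \<open>I\<close>, the elements
  there contribute equally to both sides of each counting condition and cancel, so only the traces
  on \<open>I\<close> matter.\<close>

lemma card_gale_restrict: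
  assumes fin: "finite N" and I: "I \<subseteq> N" and D: "D \<subseteq> N"
  shows "card {C \<in> gale N D. C \<inter> (N - I) = D \<inter> (N - I)} = card (gale I (D \<inter> I))"
proof -
  have split: "card (X \<inter> Y) = card (X \<inter> I \<inter> Y) + card (X \<inter> (N - I) \<inter> Y)" if "X \<subseteq> N" for X Y
  proof -
    have "finite X" using that fin by (rule finite_subset)
    then have "card (X \<inter> I \<inter> Y \<union> X \<inter> (N - I) \<inter> Y) = card (X \<inter> I \<inter> Y) + card (X \<inter> (N - I) \<inter> Y)"
      by (intro card_Un_disjoint) auto
    moreover have "X \<inter> I \<inter> Y \<union> X \<inter> (N - I) \<inter> Y = X \<inter> Y" using that by auto
    ultimately show ?thesis by simp
  qed
  have iff: "C \<in> gale N D \<longleftrightarrow> C \<inter> I \<in> gale I (D \<inter> I)"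
    if C: "C \<subseteq> N" "C \<inter> (N - I) = D \<inter> (N - I)" for C
  proof -
    have "card C = card D \<longleftrightarrow> card (C \<inter> I) = card (D \<inter> I)"
      using split[OF C(1), of UNIV] split[OF D, of UNIV] by (simp add: C(2))
    moreover have "card (D \<inter> {..<t}) \<le> card (C \<inter> {..<t}) \<longleftrightarrow>
        card (D \<inter> I \<inter> {..<t}) \<le> card (C \<inter> I \<inter> {..<t})" for t
      unfolding split[OF C(1)] split[OF D] C(2) by simp
    ultimately show ?thesis
      using C(1) by (simp add: gale_def)
  qed
  have "bij_betw (\<lambda>C. C \<inter> I) {C \<in> gale N D. C \<inter> (N - I) = D \<inter> (N - I)} (gale I (D \<inter> I))"
  proof (rule bij_betw_byWitness[where f' = "\<lambda>C. C \<union> D \<inter> (N - I)"])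
    show "(\<lambda>C. C \<inter> I) ` {C \<in> gale N D. C \<inter> (N - I) = D \<inter> (N - I)} \<subseteq> gale I (D \<inter> I)"
      using iff by (auto simp: gale_def)
    show "(\<lambda>C. C \<union> D \<inter> (N - I)) ` gale I (D \<inter> I) \<subseteq> {C \<in> gale N D. C \<inter> (N - I) = D \<inter> (N - I)}"
    proof (rule image_subsetI)
      fix C
      assume C: "C \<in> gale I (D \<inter> I)"
      define B where "B = C \<union> D \<inter> (N - I)"
      have "C \<subseteq> I"
        using C by (simp add: gale_def)
      then have "B \<subseteq> N" "B \<inter> I = C" "B \<inter> (N - I) = D \<inter> (N - I)"
        using I by (auto simp: B_def)
      with iff[of B] C show "C \<union> D \<inter> (N - I) \<in> {C \<in> gale N D. C \<inter> (N - I) = D \<inter> (N - I)}"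
        by (simp add: B_def)
    qed
  qed (auto simp: gale_def)
  then show ?thesis
    by (rule bij_betw_same_card)
qed

section \<open>Subwords, their positions and their Schubert values at ones\<close>

lemma nths_eq_map_filter: "nths w I = map ((!) w) (filter (\<lambda>i. i \<in> I) [0..<length w])"
proof -
  have upt: "nths [0..<n] I = filter (\<lambda>i. i \<in> I) [0..<n]" for n
    by (induction n) (auto simp: nths_append)
  have "nths w I = nths (map ((!) w) [0..<length w]) I"
    by (simp add: map_nth)
  also have "\<dots> = map ((!) w) (nths [0..<length w] I)"
    by (rule nths_map)
  also have "nths [0..<length w] I = filter (\<lambda>i. i \<in> I) [0..<length w]"
    by (rule upt)
  finally show ?thesis .
qed

lemma subseq_nths_mono:
  assumes "A \<subseteq> B"
  shows "subseq (nths w A) (nths w B)"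
proof -
  have "filter (\<lambda>i. i \<in> A) [0..<length w] = filter (\<lambda>i. i \<in> A) (filter (\<lambda>i. i \<in> B) [0..<length w])"
    using assms by (auto intro: filter_cong)
  then show ?thesis
    unfolding nths_eq_map_filter by (metis subseq_filter_left subseq_map)
qed

lemma not_avoidsI:
  assumes "sorted ps" "distinct ps" "\<And>i. i \<in> set ps \<Longrightarrow> i < length w"
    "same_relative_order (map ((!) w) ps) \<pi>"
  shows "\<not> avoids w \<pi>"
proof -
  have "ps = filter (\<lambda>i. i \<in> set ps) [0..<length w]"
    using assms(1-3) by (intro sorted_distinct_set_unique) (auto simp: sorted_wrt_filter)
  then have "subseq (map ((!) w) ps) w"
    by (metis map_nth subseq_filter_left subseq_map)
  with assms(4) show ?thesis
    unfolding avoids_def same_relative_order_def by blast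
qed

text \<open>Two different positions \<open>r < s\<close> would give 1432 or 1423, according to which
  of their letters is larger.\<close>

lemma thin_if_avoids:
  assumes "distinct w" "avoids w [1, 4, 3, 2]" "avoids w [1, 4, 2, 3]"
  shows "thin w"
proof -
  have no: False if *: "p < q" "q < r" "r < s" "s < length w" "w ! p < w ! r" "w ! r < w ! q"
    "w ! p < w ! s" "w ! s < w ! q" for p q r s
  proof -
    have "w ! r \<noteq> w ! s"
      using * assms(1) by (simp add: nth_eq_iff_index_eq)
    then have "same_relative_order (map ((!) w) [p, q, r, s]) [1, 4, 3, 2] \<or>
        same_relative_order (map ((!) w) [p, q, r, s]) [1, 4, 2, 3]"
      using * by (auto simp: same_relative_order_def All_less_Suc numeral_eq_Suc)
    then have "\<not> avoids w [1, 4, 3, 2] \<or> \<not> avoids w [1, 4, 2, 3]"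
      using * not_avoidsI[of "[p, q, r, s]" w] by fastforce
    with assms show False by blast
  qed
  then show ?thesis
    unfolding thin_def using assms(1) by (metis linorder_neqE_nat)
qed

text \<open>The increasing enumeration \<open>e\<close> of \<open>I\<close> shows that the
  standardized subword is again thin, and it maps the column at \<open>k\<close> onto the column of
  \<open>w\<close> at \<open>e k\<close> cut down to \<open>I\<close>. The product formula then
  applies.\<close>

lemma poly_eval_one_schubert_perm_nths:
  assumes w: "thin w" and I: "I \<subseteq> {..<length w}"
  shows "poly_eval (\<lambda>_. 1) (schubert (perm (nths w I))) =
    (\<Prod>p\<in>I. int (card (gale I (rothe_column w p \<inter> I))))"
proof -
  define xs where "xs = filter (\<lambda>i. i \<in> I) [0..<length w]"
  define m where "m = length xs"
  define e where "e = (!) xs"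
  define v where "v = perm (nths w I)"
  have xs: "sorted xs" "distinct xs" "set xs = I"
    using I by (auto simp: xs_def sorted_wrt_filter)
  have len: "length v = m"
    by (simp add: v_def perm_def nths_eq_map_filter m_def xs_def)
  have nth: "nths w I ! k = w ! e k" if "k < m" for k
    using that by (simp add: nths_eq_map_filter e_def m_def flip: xs_def)
  have e: "strict_mono_on {..<m} e"
    using xs by (intro strict_mono_onI) (simp add: e_def m_def sorted_wrt_nth_less strict_sorted_iff)
  have eI: "e ` {..<m} = I"
    using xs(3) by (auto simp: e_def m_def set_conv_nth)
  have less: "e j < e k \<longleftrightarrow> j < k" if "j < m" "k < m" for j k
    using that strict_mono_on_less[OF e] by simp
  have ek: "e k < length w" if "k < m" for k
    using that eI I by blast
  have ord: "v ! j < v ! k \<longleftrightarrow> w ! e j < w ! e k" if "j < m" "k < m" for j k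
    using same_relative_order_perm[of "nths w I"] that len
    by (simp add: same_relative_order_def nth flip: v_def)
  have "distinct (nths w I)"
    using w by (simp add: thin_def distinct_nthsI)
  then have "distinct v"
    using perm_in_permutations_of_set by (auto simp: v_def permutations_of_set_def)
  moreover have "r = s"
    if *: "p < q" "q < r" "q < s" "r < m" "s < m"
      "v ! p < v ! r" "v ! r < v ! q" "v ! p < v ! s" "v ! s < v ! q" for p q r s
  proof -
    have "e r = e s"
      using * ek by (intro thinD[OF w, of "e p" "e q"]) (auto simp: less simp flip: ord)
    with * less[of r s] less[of s r] show ?thesis by simp
  qed
  ultimately have "thin v"
    unfolding thin_def len by blast
  then have "poly_eval (\<lambda>_. 1) (schubert v) = (\<Prod>k<m. int (card (gale {..<m} (rothe_column v k))))"
    by (simp add: schubert_thin len poly_eval_one_prod poly_eval_one_gale_poly)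
  also have "\<dots> = (\<Prod>k<m. int (card (gale I (rothe_column w (e k) \<inter> I))))"
  proof (intro prod.cong refl arg_cong[where f = int])
    fix k
    assume k: "k \<in> {..<m}"
    have "e ` rothe_column v k = rothe_column w (e k) \<inter> e ` {..<m}"
      using k by (fastforce simp: rothe_column_def ord less)
    moreover have "rothe_column v k \<subseteq> {..<m}"
      using k by (auto simp: rothe_column_def)
    ultimately show "card (gale {..<m} (rothe_column v k)) = card (gale I (rothe_column w (e k) \<inter> I))"
      using card_gale_image[OF e, of "rothe_column v k"] by (simp add: eI)
  qed
  also have "\<dots> = (\<Prod>p\<in>e ` {..<m}. int (card (gale I (rothe_column w p \<inter> I))))"
    using strict_mono_on_imp_inj_on[OF e] by (simp add: prod.reindex)
  finally show ?thesis
    by (simp add: eI v_def)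
qed

section \<open>Inclusion-exclusion over families of Gale sets\<close>

lemma sum_Pow_minus_one:
  assumes "finite A"
  shows "(\<Sum>J\<in>Pow A. (-1) ^ card J) = (if A = {} then 1 else 0 :: int)"
proof -
  have "(\<Prod>a\<in>A. (-1) + 1) = (\<Sum>J\<in>Pow A. (\<Prod>a\<in>J. -1) * (\<Prod>a\<in>A - J. 1 :: int))"
    using assms by (rule prod_add)
  then have "(\<Sum>J\<in>Pow A. (-1) ^ card J) = (0 :: int) ^ card A"
    by simp
  with assms show ?thesis
    by (simp add: power_0_left)
qed

text \<open>After exchanging the sums, an element \<open>x\<close> contributes 1 if it violates
  \<open>P j\<close> for all \<open>j\<close> in \<open>T\<close>, and 0 otherwise.\<close>

lemma alternating_sum_card_nonneg:
  assumes "finite X" "finite T"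
  shows "(\<Sum>J\<in>Pow T. (-1) ^ card J * int (card {x \<in> X. \<forall>j\<in>J. P j x})) \<ge> 0"
proof -
  have "(\<Sum>J\<in>Pow T. (-1) ^ card J * int (card {x \<in> X. \<forall>j\<in>J. P j x})) =
      (\<Sum>J\<in>Pow T. \<Sum>x\<in>X. if \<forall>j\<in>J. P j x then (-1) ^ card J else 0)"
    using assms(1) by (intro sum.cong refl) (simp flip: sum.inter_filter)
  also have "\<dots> = (\<Sum>x\<in>X. \<Sum>J\<in>Pow T. if \<forall>j\<in>J. P j x then (-1) ^ card J else 0)"
    by (rule sum.swap)
  also have "\<dots> = (\<Sum>x\<in>X. \<Sum>J\<in>Pow {j \<in> T. P j x}. (-1) ^ card J)"
  proof (rule sum.cong[OF refl])
    fix x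
    have "Pow {j \<in> T. P j x} = {J \<in> Pow T. \<forall>j\<in>J. P j x}" by blast
    then show "(\<Sum>J\<in>Pow T. if \<forall>j\<in>J. P j x then (-1) ^ card J else (0 :: int)) =
        (\<Sum>J\<in>Pow {j \<in> T. P j x}. (-1) ^ card J)"
      using assms(2) by (simp flip: sum.inter_filter)
  qed
  also have "\<dots> \<ge> 0"
    using assms(2) by (simp add: sum_Pow_minus_one sum_nonneg)
  finally show ?thesis .
qed

text \<open>For every \<open>J\<close> the Schubert value counts the elements of one fixed set
  \<open>X\<close> that satisfy the conditions indexed by \<open>J\<close>, which is the shape
  inclusion-exclusion needs.\<close>

lemma thin_alternating_sum_nonneg:
  assumes w: "thin w" and n: "n = length w" and T: "T \<subseteq> {..<n}"
  shows "(\<Sum>J\<in>Pow T. (-1) ^ card J * poly_eval (\<lambda>_. 1) (schubert (perm (nths w ({..<n} - J))))) \<ge> 0"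
proof -
  let ?D = "rothe_column w"
  define X where "X = (\<Pi>\<^sub>E p\<in>{..<n}. gale {..<n} (?D p))"
  define P where "P = (\<lambda>j C. C j = ?D j \<and> (\<forall>p<n. j \<in> C p \<longleftrightarrow> j \<in> ?D p))"
  have D: "?D p \<subseteq> {..<n}" if "p < n" for p
    using that by (auto simp: rothe_column_def)
  have finX: "finite X"
    by (simp add: X_def finite_PiE finite_gale)
  have "poly_eval (\<lambda>_. 1) (schubert (perm (nths w ({..<n} - J)))) = int (card {C \<in> X. \<forall>j\<in>J. P j C})"
    if J: "J \<subseteq> {..<n}" for J
  proof -
    define I where "I = {..<n} - J"
    have NI: "{..<n} - I = J" "I \<subseteq> {..<n}" "{..<n} = I \<union> J" "I \<inter> J = {}"
      using J by (auto simp: I_def)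
    \<comment> \<open>The conditions indexed by \<open>J\<close> decouple into separate conditions
      on the columns: row agreement on \<open>J\<close> everywhere, and full agreement for columns
      in \<open>J\<close>.\<close>
    define B where "B = (\<lambda>p. {C \<in> gale {..<n} (?D p). C \<inter> J = ?D p \<inter> J \<and> (p \<in> J \<longrightarrow> C = ?D p)})"
    have "{C \<in> X. \<forall>j\<in>J. P j C} = (\<Pi>\<^sub>E p\<in>{..<n}. B p)"
    proof (intro equalityI subsetI)
      fix C
      assume "C \<in> {C \<in> X. \<forall>j\<in>J. P j C}"
      then have C: "C \<in> X" "\<And>j. j \<in> J \<Longrightarrow> P j C" by auto
      have "C p \<in> B p" if "p < n" for p
        using that C by (auto simp: X_def P_def B_def PiE_iff)
      with C(1) show "C \<in> (\<Pi>\<^sub>E p\<in>{..<n}. B p)"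
        by (simp add: X_def PiE_iff)
    next
      fix C
      assume C: "C \<in> (\<Pi>\<^sub>E p\<in>{..<n}. B p)"
      then have B: "C p \<in> B p" if "p < n" for p
        using that by auto
      have "P j C" if "j \<in> J" for j
      proof -
        have "j < n" using that J by auto
        moreover have "j \<in> C p \<longleftrightarrow> j \<in> ?D p" if "p < n" for p
          using B[OF that] \<open>j \<in> J\<close> by (auto simp: B_def)
        ultimately show ?thesis
          using B[of j] that by (simp add: P_def B_def)
      qed
      moreover have "C \<in> X"
        using C by (auto simp: X_def B_def PiE_iff)
      ultimately show "C \<in> {C \<in> X. \<forall>j\<in>J. P j C}" by simp
    qed
    then have "card {C \<in> X. \<forall>j\<in>J. P j C} = (\<Prod>p<n. card (B p))"
      by (simp add: card_PiE)
    also have "\<dots> = (\<Prod>p\<in>I. card (B p)) * (\<Prod>p\<in>J. card (B p))"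
      unfolding NI(3) using finite_subset[OF J] finite_subset[OF NI(2)] NI(4)
      by (intro prod.union_disjoint) auto
    also have "(\<Prod>p\<in>J. card (B p)) = 1"
    proof (intro prod.neutral ballI)
      fix p
      assume "p \<in> J"
      then have "B p = {?D p}"
        using J D[of p] by (auto simp: B_def gale_def)
      then show "card (B p) = 1" by simp
    qed
    also have "(\<Prod>p\<in>I. card (B p)) = (\<Prod>p\<in>I. card (gale I (?D p \<inter> I)))"
    proof (intro prod.cong refl)
      fix p
      assume p: "p \<in> I"
      then have "B p = {C \<in> gale {..<n} (?D p). C \<inter> ({..<n} - I) = ?D p \<inter> ({..<n} - I)}"
        using NI by (auto simp: B_def)
      then show "card (B p) = card (gale I (?D p \<inter> I))"
        using p NI(2) D[of p] card_gale_restrict[OF finite_lessThan NI(2), of "?D p"] by auto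
    qed
    finally show ?thesis
      using poly_eval_one_schubert_perm_nths[OF w, of I] NI(2) by (simp add: n I_def)
  qed
  then have "(\<Sum>J\<in>Pow T. (-1) ^ card J * poly_eval (\<lambda>_. 1) (schubert (perm (nths w ({..<n} - J))))) =
      (\<Sum>J\<in>Pow T. (-1) ^ card J * int (card {C \<in> X. \<forall>j\<in>J. P j C}))"
    using T by (intro sum.cong) auto
  also have "\<dots> \<ge> 0"
    using finX finite_subset[OF T] by (intro alternating_sum_card_nonneg) auto
  finally show ?thesis .
qed

section \<open>Intermediate subwords as sets of deleted positions\<close>

theorem theorem1p3:
  fixes n :: nat and w u :: "nat list"
  assumes "w \<in> permutations_of_set {1..n}"
    and "avoids w [1, 4, 3, 2]"
    and "avoids w [1, 4, 2, 3]"
    and "subseq u w"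
  shows "(\<Sum>v | subseq u v \<and> subseq v w.
            (-1) ^ (length w - length v) * poly_eval (\<lambda>_. 1) (schubert (perm v))) \<ge> 0"
proof -
  define N where "N = {..<length w}"
  have dist: "distinct w"
    using assms(1) by (simp add: permutations_of_set_def)
  then have thin: "thin w"
    using assms(2,3) by (rule thin_if_avoids)
  have inj: "inj_on ((!) w) N"
    using dist by (simp add: inj_on_nth N_def)
  have restrict: "nths w A = nths w (A \<inter> N)" for A
    by (auto simp: nths_eq_map_filter N_def intro!: arg_cong[where f = "map ((!) w)"] filter_cong)
  have set: "set (nths w A) = (!) w ` A" if "A \<subseteq> N" for A
    using that by (auto simp: nths_eq_map_filter N_def)
  obtain U where U: "u = nths w U" "U \<subseteq> N"
    using assms(4) restrict by (metis subseq_conv_nths Int_lower2)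
  \<comment> \<open>The subword left after deleting the positions in \<open>J\<close>; since the
    letters of \<open>w\<close> are distinct, it determines \<open>J\<close>.\<close>
  define sub where "sub = (\<lambda>J. nths w (N - J))"
  have "inj_on sub (Pow (N - U))"
  proof (rule inj_onI)
    fix J K
    assume JK: "J \<in> Pow (N - U)" "K \<in> Pow (N - U)" "sub J = sub K"
    then have "(!) w ` (N - J) = (!) w ` (N - K)"
      using set[of "N - J"] set[of "N - K"] by (auto simp: sub_def)
    then have "N - J = N - K"
      using inj by (simp add: inj_on_image_eq_iff)
    with JK show "J = K" by blast
  qed
  moreover have "sub ` Pow (N - U) = {v. subseq u v \<and> subseq v w}"
  proof
    show "sub ` Pow (N - U) \<subseteq> {v. subseq u v \<and> subseq v w}"
      using U by (auto simp: sub_def subseq_conv_nths[of _ w] intro!: subseq_nths_mono)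
    show "{v. subseq u v \<and> subseq v w} \<subseteq> sub ` Pow (N - U)"
    proof clarify
      fix v
      assume v: "subseq u v" "subseq v w"
      then obtain I where I: "v = nths w I" "I \<subseteq> N"
        using restrict by (metis subseq_conv_nths Int_lower2)
      \<comment> \<open>Inclusion of letter sets gives inclusion of position sets, again because
        letters of \<open>w\<close> do not repeat.\<close>
      have "(!) w ` U \<subseteq> (!) w ` I"
        using v(1) set_nths_subset U I set by (metis subseq_conv_nths)
      then have "U \<subseteq> I"
        using U(2) inj_on_image_mem_iff[OF inj _ I(2)] by blast
      then show "v \<in> sub ` Pow (N - U)"
        using I by (intro image_eqI[of _ _ "N - I"]) (auto simp: sub_def double_diff)
    qed
  qed
  ultimately have bij: "bij_betw sub (Pow (N - U)) {v. subseq u v \<and> subseq v w}"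
    by (simp add: bij_betw_def)
  have len: "length w - length (sub J) = card J" if "J \<subseteq> N" for J
  proof -
    have "length (sub J) = card (N - J)"
      by (auto simp: sub_def length_nths N_def intro: arg_cong[where f = card])
    also have "\<dots> = length w - card J"
      using that by (subst card_Diff_subset) (auto simp: N_def intro: finite_subset)
    \<comment> \<open>The natural-number subtraction is exact, since \<open>J\<close> lies inside
      \<open>N\<close>.\<close>
    finally show ?thesis
      using that card_mono[of N J] by (simp add: N_def)
  qed
  have "(\<Sum>v | subseq u v \<and> subseq v w.
        (-1) ^ (length w - length v) * poly_eval (\<lambda>_. 1) (schubert (perm v))) =
      (\<Sum>J\<in>Pow (N - U). (-1) ^ (length w - length (sub J)) * poly_eval (\<lambda>_. 1) (schubert (perm (sub J))))"
    by (rule sum.reindex_bij_betw[OF bij, symmetric])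
  also have "\<dots> = (\<Sum>J\<in>Pow (N - U). (-1) ^ card J * poly_eval (\<lambda>_. 1) (schubert (perm (nths w (N - J)))))"
  proof (rule sum.cong[OF refl])
    fix J
    assume "J \<in> Pow (N - U)"
    then have "J \<subseteq> N" by blast
    then show "(-1) ^ (length w - length (sub J)) * poly_eval (\<lambda>_. 1) (schubert (perm (sub J))) =
        (-1) ^ card J * poly_eval (\<lambda>_. 1) (schubert (perm (nths w (N - J))))"
      unfolding len[OF \<open>J \<subseteq> N\<close>] by (simp add: sub_def)
  qed
  also have "\<dots> \<ge> 0"
    unfolding N_def by (rule thin_alternating_sum_nonneg[OF thin refl]) auto
  finally show ?thesis .
qed

end
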